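(* Let $\Delta t,\Delta w>0$ and consider the scheme $$f_i^{n+1}=f_i^n+\Delta t\,\frac{\mathcal F^n_{i+1/2}-\mathcal F^n_{i-1/2}}{\Delta w},\qquad i=0,\dots,N,\quad n\in\mathbb N,$$ with no-flux boundary conditions $\mathcal F^n_{N+1/2}=\mathcal F^n_{-1/2}=0$ for all $n$. Then for all $n\in\mathbb N$ $$\sum_{i=0}^N f_i^{n+1}=\sum_{i=0}^N f_i^n .$$
   Context: The scheme is a forward Euler, conservative discretization of $\partial_t f=\partial_w\left[(\mathcal B[f]+D')f+D\,\partial_w f\right]$ on a uniform grid $w_0<\dots<w_N$ of spacing $\Delta w$, with $w_{i+1/2}=w_i+\Delta w/2$, $D_{i+1/2}=D(w_{i+1/2})>0$. The interior numerical fluxes ($i=0,\dots,N-1$) are the real numbers $$\mathcal F^n_{i+1/2}=\tilde{\mathcal C}^n_{i+1/2}\left[(1-\delta^n_{i+1/2})f^n_{i+1}+\delta^n_{i+1/2}f^n_i\right]+D_{i+1/2}\frac{f^n_{i+1}-f^n_i}{\Delta w},$$ $$\lambda^n_{i+1/2}=\int_{w_i}^{w_{i+1}}\frac{\mathcal B[f^n](w)+D'(w)}{D(w)}\,dw,\qquad \tilde{\mathcal C}^n_{i+1/2}=\frac{D_{i+1/2}}{\Delta w}\lambda^n_{i+1/2},\qquad \delta^n_{i+1/2}=\frac{1}{\lambda^n_{i+1/2}}+\frac{1}{1-\exp(\lambda^n_{i+1/2})},$$ with the integrals assumed finite and $\delta^n_{i+1/2}=1/2$ if $\lambda^n_{i+1/2}=0$.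 *)

theory Defs
  imports "HOL-Analysis.Analysis"
begin

definition grid :: "real \<Rightarrow> real \<Rightarrow> nat \<Rightarrow> real" where
  "grid w0 dw i = w0 + real i * dw"

definition grid_half :: "real \<Rightarrow> real \<Rightarrow> nat \<Rightarrow> real" where
  "grid_half w0 dw i = grid w0 dw i + dw / 2"

text \<open>The operator \<open>\<B>\<close> maps a grid function \<open>i \<mapsto> f\<^sub>i\<close> to a function of the
  continuous variable \<open>w\<close>.\<close>

definition drift_ratio ::
    "((nat \<Rightarrow> real) \<Rightarrow> real \<Rightarrow> real) \<Rightarrow> (real \<Rightarrow> real) \<Rightarrow> (nat \<Rightarrow> real) \<Rightarrow> real \<Rightarrow> real" where
  "drift_ratio B D g w = (B g w + deriv D w) / D w"

text \<open>The functions below with a cell index \<open>i\<close> denote the quantity at the interface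
  \<open>i + 1/2\<close>.\<close>

definition lam ::
    "real \<Rightarrow> real \<Rightarrow> ((nat \<Rightarrow> real) \<Rightarrow> real \<Rightarrow> real) \<Rightarrow> (real \<Rightarrow> real) \<Rightarrow> (nat \<Rightarrow> real) \<Rightarrow> nat \<Rightarrow> real" where
  "lam w0 dw B D g i = integral {grid w0 dw i..grid w0 dw (i + 1)} (drift_ratio B D g)"

definition Ctilde ::
    "real \<Rightarrow> real \<Rightarrow> ((nat \<Rightarrow> real) \<Rightarrow> real \<Rightarrow> real) \<Rightarrow> (real \<Rightarrow> real) \<Rightarrow> (nat \<Rightarrow> real) \<Rightarrow> nat \<Rightarrow> real" where
  "Ctilde w0 dw B D g i = D (grid_half w0 dw i) / dw * lam w0 dw B D g i"

definition delta_weight :: "real \<Rightarrow> real" where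
  "delta_weight l = (if l = 0 then 1 / 2 else 1 / l + 1 / (1 - exp l))"

definition delta ::
    "real \<Rightarrow> real \<Rightarrow> ((nat \<Rightarrow> real) \<Rightarrow> real \<Rightarrow> real) \<Rightarrow> (real \<Rightarrow> real) \<Rightarrow> (nat \<Rightarrow> real) \<Rightarrow> nat \<Rightarrow> real" where
  "delta w0 dw B D g i = delta_weight (lam w0 dw B D g i)"

definition interior_flux ::
    "real \<Rightarrow> real \<Rightarrow> ((nat \<Rightarrow> real) \<Rightarrow> real \<Rightarrow> real) \<Rightarrow> (real \<Rightarrow> real) \<Rightarrow> (nat \<Rightarrow> real) \<Rightarrow> nat \<Rightarrow> real" where
  "interior_flux w0 dw B D g i =
     Ctilde w0 dw B D g i *
       ((1 - delta w0 dw B D g i) * g (i + 1) + delta w0 dw B D g i * g i) +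
     D (grid_half w0 dw i) * ((g (i + 1) - g i) / dw)"

end

theory Submission
  imports Defs
begin

text \<open>The update is in conservation form: the flux at \<open>i + 1/2\<close> is added to cell
  \<open>i\<close> and subtracted from cell \<open>i + 1\<close> with the same factor
  \<open>dt / dw\<close>. Summing over all cells therefore cancels every interior flux, and only the
  two boundary fluxes survive, which vanish. \<open>sum_flux_differences\<close> is this
  telescoping. Its indices are integers so that \<open>- 1\<close> is a genuine interface; on
  naturals \<open>0 - 1 = 0\<close> would lose the left boundary flux.\<close>

lemma sum_flux_differences:
  fixes G :: "int \<Rightarrow> 'a::ab_group_add"
  shows "(\<Sum>i=0..N. G (int i) - G (int i - 1)) = G (int N) - G (- 1)"
  by (induction N) simp_all

theorem lemma1:
  fixes N :: nat and w0 dw dt :: real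
    and D :: "real \<Rightarrow> real"
    and B :: "(nat \<Rightarrow> real) \<Rightarrow> real \<Rightarrow> real"
    and f :: "nat \<Rightarrow> nat \<Rightarrow> real"
    and F :: "nat \<Rightarrow> int \<Rightarrow> real"  (* F n i is the flux at time level n and interface i + 1/2, -1 \<le> i \<le> N *)
  assumes dt_pos: "dt > 0" and dw_pos: "dw > 0"
    and D_diff: "D differentiable_on {grid w0 dw 0<..<grid w0 dw N}"
    and D_pos: "\<And>i. i < N \<Longrightarrow> D (grid_half w0 dw i) > 0"
    and lam_finite: "\<And>n i. i < N \<Longrightarrow>
      drift_ratio B D (f n) integrable_on {grid w0 dw i..grid w0 dw (i + 1)}"
    and interior: "\<And>n i. i < N \<Longrightarrow> F n (int i) = interior_flux w0 dw B D (f n) i"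
    and no_flux_left: "\<And>n. F n (- 1) = 0"
    and no_flux_right: "\<And>n. F n (int N) = 0"
    and scheme: "\<And>n i. i \<le> N \<Longrightarrow>
      f (n + 1) i = f n i + dt * ((F n (int i) - F n (int i - 1)) / dw)"
  shows "\<forall>n. (\<Sum>i=0..N. f (n + 1) i) = (\<Sum>i=0..N. f n i)"
proof
  fix n
  have "(\<Sum>i=0..N. f (n + 1) i)
      = (\<Sum>i=0..N. f n i + dt * ((F n (int i) - F n (int i - 1)) / dw))"
    by (intro sum.cong) (simp_all only: atLeastAtMost_iff scheme)
  also have "\<dots> = (\<Sum>i=0..N. f n i)
      + dt * ((\<Sum>i=0..N. F n (int i) - F n (int i - 1)) / dw)"
    by (simp only: sum.distrib sum_distrib_left sum_divide_distrib)
  \<comment> \<open>Telescoping with \<open>G = F n\<close> leaves the right boundary flux minus the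
    left one, so the total increment is \<open>dt * ((0 - 0) / dw)\<close>.\<close>
  also have "\<dots> = (\<Sum>i=0..N. f n i)"
    by (simp only: sum_flux_differences no_flux_left no_flux_right) simp
  finally show "(\<Sum>i=0..N. f (n + 1) i) = (\<Sum>i=0..N. f n i)" .
qed

end
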